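(* For properties $X,Y$ of subsets of $\mathbb{N}$, write $X\Rightarrow Y$ if every $A\subseteq\mathbb{N}$ with property $X$ has property $Y$, and $X\not\Rightarrow Y$ if some $A\subseteq\mathbb{N}$ has property $X$ but not property $Y$. Then: (a) MAX* $\Rightarrow$ M-central*, but M-central* $\not\Rightarrow$ MAX*. (b) MAX* $\Rightarrow$ A-IP*, but A-IP* $\not\Rightarrow$ MAX*. (c) A-thick $\not\Rightarrow$ MAX*, and MAX* $\not\Rightarrow$ A-thick. (d) NMAX* $\Rightarrow$ A-thick.
   Context: $\mathbb{N}$ is the set of positive integers, and $\beta\mathbb{N}$ is the set of all ultrafilters on $\mathbb{N}$. For $A\subseteq\mathbb{N}$, $n\in\mathbb{N}$: $A/n=\{a/n:a\in A,\ n\mid a\}$, $A\!\uparrow\;=\{n\in\mathbb{N}:(\exists a\in A)\ a\mid n\}$, $n\mathbb{N}=\{nk:k\in\mathbb{N}\}$. For $\mathcal{F},\mathcal{G}\in\beta\mathbb{N}$, $\mathcal{F}\cdot\mathcal{G}=\{A\subseteq\mathbb{N}:\{n\in\mathbb{N}:A/n\in\mathcal{G}\}\in\mathcal{F}\}$; $(\beta\mathbb{N},\cdot)$ is a semigroup with smallest ideal $K(\beta\mathbb{N},\cdot)$. $\mathcal{F}\,\widetilde{\mid}\,\mathcal{G}$ ("$\mathcal{G}$ is divisible by $\mathcal{F}$") means that $A\!\uparrow\;\in\mathcal{G}$ for every $A\in\mathcal{F}$. An ultrafilter $\mathcal{F}$ is divisible by $n\in\mathbb{N}$ iff $n\mathbb{N}\in\mathcal{F}$;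 it is $\mathbb{N}$-free if it is not divisible by any $n\in\mathbb{N}\setminus\{1\}$. $MAX$ is the set of all $\mathcal{G}\in\beta\mathbb{N}$ such that $\mathcal{F}\,\widetilde{\mid}\,\mathcal{G}$ for all $\mathcal{F}\in\beta\mathbb{N}$ (equivalently, $\mathcal{G}$ contains every nonempty $A$ with $A=A\!\uparrow$). A set $A\subseteq\mathbb{N}$ is: - A-IP if there is a sequence $\langle x_n:n\in\mathbb{N}\rangle$ in $\mathbb{N}$ such that $\sum_{n\in F}x_n\in A$ for every nonempty finite $F\subseteq\mathbb{N}$; A-IP* if it intersects every A-IP set; - M-central if it is a member of some idempotent of $(\beta\mathbb{N},\cdot)$ belonging to $K(\beta\mathbb{N},\cdot)$; M-central* if it intersects every M-central set; - A-thick if for every $n\in\mathbb{N}$ there is $m\in\mathbb{N}$ with $\{m+1,m+2,\dots,m+n\}\subseteq A$; - a MAX-set if it is a member of some ultrafilter in $MAX$; MAX* if it intersects every MAX-set (equivalently, it belongs to every ultrafilter in $MAX$); - an NMAX-set if it is a member of some ultrafilter that is $\widetilde{\mid}$-divisible by all $\mathbb{N}$-free ultrafilters; NMAX* if it intersects every NMAX-set (equivalently, it belongs to every ultrafilter $\widetilde{\mid}$-divisible by all $\mathbb{N}$-free ultrafilters). *)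

theory Defs
  imports Main
begin

abbreviation Npos :: "nat set" where
  "Npos \<equiv> {0<..}"

text \<open>
  The library type of filters lives on a whole type, contains the improper filter and has no
  notion of ultrafilter.  Ultrafilters on the positive integers are therefore families of subsets
  of \<^term>\<open>Npos\<close>.
\<close>

definition is_ultrafilter :: "nat set set \<Rightarrow> bool" where
  "is_ultrafilter F \<longleftrightarrow>
     F \<subseteq> Pow Npos \<and> Npos \<in> F \<and> {} \<notin> F \<and>
     (\<forall>A B. A \<in> F \<and> A \<subseteq> B \<and> B \<subseteq> Npos \<longrightarrow> B \<in> F) \<and>
     (\<forall>A B. A \<in> F \<and> B \<in> F \<longrightarrow> A \<inter> B \<in> F) \<and>
     (\<forall>A. A \<subseteq> Npos \<longrightarrow> A \<in> F \<or> Npos - A \<in> F)"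

definition betaN :: "nat set set set" where
  "betaN = {F. is_ultrafilter F}"

definition set_quot :: "nat set \<Rightarrow> nat \<Rightarrow> nat set" where
  "set_quot A n = {a div n | a. a \<in> A \<and> n dvd a}"

definition up_closure :: "nat set \<Rightarrow> nat set" where
  "up_closure A = {n \<in> Npos. \<exists>a\<in>A. a dvd n}"

definition multiples :: "nat \<Rightarrow> nat set" where
  "multiples n = {n * k | k. k \<in> Npos}"

definition uf_mult :: "nat set set \<Rightarrow> nat set set \<Rightarrow> nat set set" where
  "uf_mult F G = {A. A \<subseteq> Npos \<and> {n \<in> Npos. set_quot A n \<in> G} \<in> F}"

lemma set_quot_eq: "n > 0 \<Longrightarrow> set_quot A n = {m. n * m \<in> A}"
  unfolding set_quot_def by (auto intro!: exI[of _ "n * _"])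

lemma uf_mult_in_betaN:
  assumes "F \<in> betaN" "G \<in> betaN"
  shows "uf_mult F G \<in> betaN"
proof -
  define q where "q A = {n \<in> Npos. set_quot A n \<in> G}" for A
  have F: "is_ultrafilter F" and G: "is_ultrafilter G"
    using assms by (auto simp: betaN_def)
  have sub: "set_quot A n \<subseteq> Npos" if "n \<in> Npos" "A \<subseteq> Npos" for A n
    using that by (auto simp: set_quot_eq)
  have up: "Y \<in> F" if "X \<in> F" "X \<subseteq> Y" "Y \<subseteq> Npos" for X Y
    using F that unfolding is_ultrafilter_def by blast
  have upG: "Y \<in> G" if "X \<in> G" "X \<subseteq> Y" "Y \<subseteq> Npos" for X Y
    using G that unfolding is_ultrafilter_def by blast
  have top: "q Npos = Npos"
  proof -
    have "set_quot Npos n = Npos" if "n \<in> Npos" for n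
      using that by (auto simp: set_quot_eq)
    then show ?thesis using G by (auto simp: q_def is_ultrafilter_def)
  qed
  have bot: "q {} = {}"
    using G by (auto simp: q_def set_quot_eq is_ultrafilter_def)
  have mono: "q A \<subseteq> q B" if "A \<subseteq> B" "B \<subseteq> Npos" for A B
  proof
    fix n assume n: "n \<in> q A"
    then have "set_quot A n \<subseteq> set_quot B n"
      using that by (auto simp: q_def set_quot_eq)
    moreover have "set_quot B n \<subseteq> Npos"
      using n sub[of n B] that by (auto simp: q_def)
    ultimately have "set_quot B n \<in> G"
      using n upG by (auto simp: q_def)
    then show "n \<in> q B"
      using n by (auto simp: q_def)
  qed
  have int: "q A \<inter> q B \<subseteq> q (A \<inter> B)" for A B
  proof
    fix n assume n: "n \<in> q A \<inter> q B"
    then have "set_quot (A \<inter> B) n = set_quot A n \<inter> set_quot B n"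
      by (auto simp: q_def set_quot_eq)
    moreover have "set_quot A n \<inter> set_quot B n \<in> G"
      using n G unfolding q_def is_ultrafilter_def by blast
    ultimately show "n \<in> q (A \<inter> B)"
      using n by (auto simp: q_def)
  qed
  have compl: "Npos - q A \<subseteq> q (Npos - A)" if "A \<subseteq> Npos" for A
  proof
    fix n assume n: "n \<in> Npos - q A"
    then have "set_quot (Npos - A) n = Npos - set_quot A n"
      by (auto simp: q_def set_quot_eq)
    moreover have "set_quot A n \<in> G \<or> Npos - set_quot A n \<in> G"
      using G sub[of n A] n that unfolding is_ultrafilter_def by blast
    ultimately show "n \<in> q (Npos - A)"
      using n by (auto simp: q_def)
  qed
  have qN: "q A \<subseteq> Npos" for A by (auto simp: q_def)
  have m: "uf_mult F G = {A. A \<subseteq> Npos \<and> q A \<in> F}"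
    by (simp add: uf_mult_def q_def)
  have "is_ultrafilter {A. A \<subseteq> Npos \<and> q A \<in> F}"
    unfolding is_ultrafilter_def
  proof (intro conjI allI impI)
    show "Npos \<in> {A. A \<subseteq> Npos \<and> q A \<in> F}" "{} \<notin> {A. A \<subseteq> Npos \<and> q A \<in> F}"
      using F top bot by (auto simp: is_ultrafilter_def)
  next
    fix A B assume "A \<in> {A. A \<subseteq> Npos \<and> q A \<in> F} \<and> A \<subseteq> B \<and> B \<subseteq> Npos"
    then show "B \<in> {A. A \<subseteq> Npos \<and> q A \<in> F}"
      using up[OF _ mono qN] by blast
  next
    fix A B assume AB: "A \<in> {A. A \<subseteq> Npos \<and> q A \<in> F} \<and> B \<in> {A. A \<subseteq> Npos \<and> q A \<in> F}"
    then have "q A \<inter> q B \<in> F"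
      using F unfolding is_ultrafilter_def by blast
    then show "A \<inter> B \<in> {A. A \<subseteq> Npos \<and> q A \<in> F}"
      using up[OF _ int qN] AB by blast
  next
    fix A assume A: "A \<subseteq> Npos"
    then have "q A \<in> F \<or> Npos - q A \<in> F"
      using F qN[of A] unfolding is_ultrafilter_def by simp
    then show "A \<in> {A. A \<subseteq> Npos \<and> q A \<in> F} \<or> Npos - A \<in> {A. A \<subseteq> Npos \<and> q A \<in> F}"
      using up[OF _ compl[OF A] qN] A by auto
  qed auto
  then show ?thesis by (simp add: m betaN_def)
qed

definition two_sided_ideal :: "'a set \<Rightarrow> ('a \<Rightarrow> 'a \<Rightarrow> 'a) \<Rightarrow> 'a set \<Rightarrow> bool" where
  "two_sided_ideal S mult I \<longleftrightarrow>
     I \<noteq> {} \<and> I \<subseteq> S \<and> (\<forall>x\<in>S. \<forall>y\<in>I. mult x y \<in> I \<and> mult y x \<in> I)"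

text \<open>
  Whenever a semigroup has a smallest ideal (as every compact right topological semigroup does),
  it is the intersection of all ideals.
\<close>

definition smallest_ideal :: "'a set \<Rightarrow> ('a \<Rightarrow> 'a \<Rightarrow> 'a) \<Rightarrow> 'a set" where
  "smallest_ideal S mult = \<Inter> {I. two_sided_ideal S mult I}"

lemma smallest_ideal_eqI:
  assumes "two_sided_ideal S mult K"
    and "\<And>I. two_sided_ideal S mult I \<Longrightarrow> K \<subseteq> I"
  shows "smallest_ideal S mult = K"
  using assms unfolding smallest_ideal_def by blast

definition uf_dvd :: "nat set set \<Rightarrow> nat set set \<Rightarrow> bool" where
  "uf_dvd F G \<longleftrightarrow> (\<forall>A\<in>F. up_closure A \<in> G)"

definition N_free :: "nat set set \<Rightarrow> bool" where
  "N_free F \<longleftrightarrow> (\<forall>n \<in> Npos - {1}. multiples n \<notin> F)"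

definition MAX_ultrafilters :: "nat set set set" where
  "MAX_ultrafilters = {G \<in> betaN. \<forall>F \<in> betaN. uf_dvd F G}"

definition NMAX_ultrafilters :: "nat set set set" where
  "NMAX_ultrafilters = {G \<in> betaN. \<forall>F \<in> betaN. N_free F \<longrightarrow> uf_dvd F G}"

text \<open>The predicates below are only meaningful for subsets of \<^term>\<open>Npos\<close>; \<open>star\<close> and
  \<open>prop_implies\<close> quantify accordingly.\<close>

definition star :: "(nat set \<Rightarrow> bool) \<Rightarrow> nat set \<Rightarrow> bool" where
  "star P A \<longleftrightarrow> (\<forall>B. B \<subseteq> Npos \<and> P B \<longrightarrow> A \<inter> B \<noteq> {})"

definition A_IP :: "nat set \<Rightarrow> bool" where
  "A_IP A \<longleftrightarrow>
     (\<exists>x :: nat \<Rightarrow> nat. (\<forall>n\<in>Npos. x n \<in> Npos) \<and>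
        (\<forall>F. F \<subseteq> Npos \<and> finite F \<and> F \<noteq> {} \<longrightarrow> (\<Sum>n\<in>F. x n) \<in> A))"

definition M_central :: "nat set \<Rightarrow> bool" where
  "M_central A \<longleftrightarrow>
     (\<exists>F \<in> smallest_ideal betaN uf_mult. uf_mult F F = F \<and> A \<in> F)"

definition A_thick :: "nat set \<Rightarrow> bool" where
  "A_thick A \<longleftrightarrow> (\<forall>n\<in>Npos. \<exists>m\<in>Npos. {m + 1..m + n} \<subseteq> A)"

definition MAX_set :: "nat set \<Rightarrow> bool" where
  "MAX_set A \<longleftrightarrow> (\<exists>F \<in> MAX_ultrafilters. A \<in> F)"

definition NMAX_set :: "nat set \<Rightarrow> bool" where
  "NMAX_set A \<longleftrightarrow> (\<exists>F \<in> NMAX_ultrafilters. A \<in> F)"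

definition prop_implies :: "(nat set \<Rightarrow> bool) \<Rightarrow> (nat set \<Rightarrow> bool) \<Rightarrow> bool" where
  "prop_implies X Y \<longleftrightarrow> (\<forall>A. A \<subseteq> Npos \<and> X A \<longrightarrow> Y A)"

end

theory Submission
  imports Defs "HOL-Number_Theory.Cong"
begin

text \<open>
  All four parts reduce to elementary number theory once the two star classes are unwound.

  A nonempty set that is closed under multiples contains some \<open>n\<nat>\<close>, and conversely each \<open>n\<nat>\<close> is
  such a set.  Hence the ultrafilters in \<open>MAX\<close> are those containing every \<open>n\<nat>\<close>, and
  a set is \<open>MAX*\<close> precisely if it includes some \<open>n\<nat>\<close> (\<open>star_MAX_set_iff\<close>).  The set \<open>n\<nat>\<close> meets
  every A-IP set, by the pigeonhole principle applied to partial sums modulo \<open>n\<close>, and it belongs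
  to every ultrafilter in the smallest ideal, because the ultrafilters containing it form an ideal.
  This gives the positive halves of (a) and (b), and \<open>2\<nat>\<close> is \<open>MAX*\<close> without being A-thick.

  One set refutes the three remaining implications: the complement of the set of factorials \<open>k!\<close>
  with \<open>k \<ge> 2\<close>.  Every \<open>n\<nat>\<close> contains a factorial, so this complement is not \<open>MAX*\<close>.  On the other
  hand factorials are so sparse that their complement is A-thick, that no two of them add up to a
  third, which excludes A-IP subsets, and that for \<open>m \<noteq> m'\<close> only finitely many \<open>k\<close> make both
  \<open>m * k\<close> and \<open>m' * k\<close> factorials, which keeps them out of every nonprincipal idempotent.

  For (d), the members of an \<open>\<nat>\<close>-free ultrafilter contain elements coprime to any given number.
  Given a set with this property that is closed under multiples, one can pick pairwise coprime
  elements in it, and the Chinese remainder theorem places multiples of them at consecutive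
  positions: the set is A-thick.  Such sets are closed under intersection, so if \<open>A\<close> is not
  A-thick, its complement meets all of them, and some ultrafilter extends them together with that
  complement; hence \<open>A\<close> is not \<open>NMAX*\<close>.
\<close>

section \<open>Ultrafilters on the positive integers\<close>

definition is_filter :: "nat set set \<Rightarrow> bool" where
  "is_filter H \<longleftrightarrow> H \<subseteq> Pow Npos \<and> Npos \<in> H \<and> {} \<notin> H \<and>
     (\<forall>A B. A \<in> H \<and> A \<subseteq> B \<and> B \<subseteq> Npos \<longrightarrow> B \<in> H) \<and>
     (\<forall>A B. A \<in> H \<and> B \<in> H \<longrightarrow> A \<inter> B \<in> H)"

lemma is_filter_D:
  assumes "is_filter H"
  shows is_filter_subset: "A \<in> H \<Longrightarrow> A \<subseteq> Npos"
    and is_filter_Npos: "Npos \<in> H"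
    and is_filter_empty: "{} \<notin> H"
    and is_filter_mono: "A \<in> H \<Longrightarrow> A \<subseteq> B \<Longrightarrow> B \<subseteq> Npos \<Longrightarrow> B \<in> H"
    and is_filter_Int: "A \<in> H \<Longrightarrow> B \<in> H \<Longrightarrow> A \<inter> B \<in> H"
proof -
  note H = assms[unfolded is_filter_def]
  show "A \<in> H \<Longrightarrow> A \<subseteq> Npos" "Npos \<in> H" "{} \<notin> H"
    using H by auto
  show "A \<in> H \<Longrightarrow> A \<subseteq> B \<Longrightarrow> B \<subseteq> Npos \<Longrightarrow> B \<in> H"
    using H by metis
  show "A \<in> H \<Longrightarrow> B \<in> H \<Longrightarrow> A \<inter> B \<in> H"
    using H by metis
qed

lemma betaN_iff:
  "F \<in> betaN \<longleftrightarrow> is_filter F \<and> (\<forall>A. A \<subseteq> Npos \<longrightarrow> A \<in> F \<or> Npos - A \<in> F)"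
  unfolding betaN_def is_ultrafilter_def is_filter_def by simp

lemma betaN_D:
  assumes "F \<in> betaN"
  shows betaN_is_filter: "is_filter F"
    and betaN_compl: "A \<subseteq> Npos \<Longrightarrow> A \<notin> F \<Longrightarrow> Npos - A \<in> F"
  using assms unfolding betaN_iff by auto

lemmas betaN_subset = is_filter_subset[OF betaN_is_filter]
  and betaN_Npos = is_filter_Npos[OF betaN_is_filter]
  and betaN_empty = is_filter_empty[OF betaN_is_filter]
  and betaN_mono = is_filter_mono[OF betaN_is_filter]
  and betaN_Int = is_filter_Int[OF betaN_is_filter]

lemma betaN_disjoint:
  assumes "F \<in> betaN" "A \<in> F" "B \<in> F"
  shows "A \<inter> B \<noteq> {}"
  using betaN_Int[OF assms] betaN_empty[OF assms(1)] by auto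

lemma principal_in_betaN:
  "n \<in> Npos \<Longrightarrow> {A. A \<subseteq> Npos \<and> n \<in> A} \<in> betaN"
  by (auto simp: betaN_def is_ultrafilter_def)

text \<open>
  The filter generated by the traces on \<open>C\<close> of a family closed under intersection.  It serves
  both to start the maximality argument below and, applied to a maximal filter, to finish it.
\<close>

lemma is_filter_traces:
  assumes S: "S \<noteq> {}" "\<And>D E. D \<in> S \<Longrightarrow> E \<in> S \<Longrightarrow> D \<inter> E \<in> S"
    and meets: "\<And>D. D \<in> S \<Longrightarrow> D \<inter> C \<noteq> {}" and C: "C \<subseteq> Npos"
  shows "is_filter {B. B \<subseteq> Npos \<and> (\<exists>D\<in>S. D \<inter> C \<subseteq> B)}" (is "is_filter ?H")
  unfolding is_filter_def
proof (intro conjI allI impI)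
  show "?H \<subseteq> Pow Npos" by auto
  show "Npos \<in> ?H" using S(1) C by auto
  show "{} \<notin> ?H" using meets by auto
  show "B \<in> ?H" if "A \<in> ?H \<and> A \<subseteq> B \<and> B \<subseteq> Npos" for A B
    using that by auto
  show "A \<inter> B \<in> ?H" if AB: "A \<in> ?H \<and> B \<in> ?H" for A B
  proof -
    obtain D E where DE: "D \<in> S" "D \<inter> C \<subseteq> A" "E \<in> S" "E \<inter> C \<subseteq> B"
      using AB by auto
    then have "D \<inter> E \<in> S" "D \<inter> E \<inter> C \<subseteq> A \<inter> B" using S(2) by auto
    moreover have "A \<inter> B \<subseteq> Npos" using AB by auto
    ultimately show ?thesis by (intro CollectI conjI bexI[of _ "D \<inter> E"])
  qed
qed

lemma is_filter_chain_Union: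
  assumes "\<C> \<noteq> {}" "subset.chain {H. is_filter H \<and> E \<subseteq> H} \<C>"
  shows "is_filter (\<Union>\<C>) \<and> E \<subseteq> \<Union>\<C>"
proof -
  have fil: "is_filter H" "E \<subseteq> H" if "H \<in> \<C>" for H
    using assms that by (auto simp: subset.chain_def)
  have tot: "H \<subseteq> K \<or> K \<subseteq> H" if "H \<in> \<C>" "K \<in> \<C>" for H K
    using assms(2) that unfolding subset_chain_def by blast
  have "is_filter (\<Union>\<C>)"
    unfolding is_filter_def
  proof (intro conjI allI impI)
    show "\<Union>\<C> \<subseteq> Pow Npos" using is_filter_subset[OF fil(1)] by auto
    show "Npos \<in> \<Union>\<C>" using is_filter_Npos[OF fil(1)] assms(1) by auto
    show "{} \<notin> \<Union>\<C>" using is_filter_empty[OF fil(1)] by auto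
    show "B \<in> \<Union>\<C>" if "A \<in> \<Union>\<C> \<and> A \<subseteq> B \<and> B \<subseteq> Npos" for A B
      using that is_filter_mono[OF fil(1)] by auto
    show "A \<inter> B \<in> \<Union>\<C>" if AB: "A \<in> \<Union>\<C> \<and> B \<in> \<Union>\<C>" for A B
    proof -
      obtain H K where "H \<in> \<C>" "A \<in> H" "K \<in> \<C>" "B \<in> K" using AB by auto
      then obtain L where L: "L \<in> \<C>" "A \<in> L" "B \<in> L" using tot by (metis subsetD)
      then show ?thesis using is_filter_Int[OF fil(1)[OF L(1)] L(2,3)] by auto
    qed
  qed
  moreover obtain H where "H \<in> \<C>" using assms(1) by auto
  then have "E \<subseteq> \<Union>\<C>" using fil(2) by auto
  ultimately show ?thesis by simp
qed

text \<open>
  A filter that is maximal by Zorn's lemma is an ultrafilter: if \<open>A\<close> meets all its members, its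
  traces on \<open>A\<close> generate a filter that cannot be larger; otherwise some member lies in the
  complement of \<open>A\<close>.
\<close>

lemma ultrafilter_extension:
  assumes S: "S \<noteq> {}" "S \<subseteq> Pow Npos" "\<And>D E. D \<in> S \<Longrightarrow> E \<in> S \<Longrightarrow> D \<inter> E \<in> S"
    and meets: "\<And>D. D \<in> S \<Longrightarrow> D \<inter> C \<noteq> {}" and C: "C \<subseteq> Npos"
  obtains F where "F \<in> betaN" "C \<in> F" "S \<subseteq> F"
proof -
  define E where "E = {B. B \<subseteq> Npos \<and> (\<exists>D\<in>S. D \<inter> C \<subseteq> B)}"
  have E: "is_filter E"
    unfolding E_def by (rule is_filter_traces[OF S(1,3) meets C])
  have "\<exists>M\<in>{H. is_filter H \<and> E \<subseteq> H}. \<forall>H\<in>{H. is_filter H \<and> E \<subseteq> H}. M \<subseteq> H \<longrightarrow> H = M"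
  proof (rule subset_Zorn_nonempty)
    show "{H. is_filter H \<and> E \<subseteq> H} \<noteq> {}" using E by auto
    show "\<Union>\<C> \<in> {H. is_filter H \<and> E \<subseteq> H}"
      if "\<C> \<noteq> {}" "subset.chain {H. is_filter H \<and> E \<subseteq> H} \<C>" for \<C>
      using is_filter_chain_Union[OF that] by simp
  qed
  then obtain M where M: "is_filter M" "E \<subseteq> M"
    and max: "\<And>H. is_filter H \<Longrightarrow> E \<subseteq> H \<Longrightarrow> M \<subseteq> H \<Longrightarrow> H = M"
    by auto
  have "A \<in> M \<or> Npos - A \<in> M" if A: "A \<subseteq> Npos" for A
  proof (cases "\<forall>X\<in>M. X \<inter> A \<noteq> {}")
    case True
    let ?H = "{B. B \<subseteq> Npos \<and> (\<exists>X\<in>M. X \<inter> A \<subseteq> B)}"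
    have N: "Npos \<in> M" using is_filter_Npos[OF M(1)] .
    then have "M \<noteq> {}" by auto
    then have "is_filter ?H"
      using is_filter_Int[OF M(1)] True A by (intro is_filter_traces) auto
    moreover have "M \<subseteq> ?H" using is_filter_subset[OF M(1)] by auto
    moreover have "A \<in> ?H" using N A by auto
    ultimately show ?thesis using max[of ?H] M(2) by auto
  next
    case False
    then obtain X where X: "X \<in> M" "X \<inter> A = {}" by auto
    then have "X \<subseteq> Npos - A" using is_filter_subset[OF M(1) X(1)] by auto
    then have "Npos - A \<in> M" using is_filter_mono[OF M(1) X(1)] by auto
    then show ?thesis ..
  qed
  then have "M \<in> betaN" using M(1) unfolding betaN_iff by simp
  moreover have "C \<in> E" using S(1) C by (auto simp: E_def)
  then have "C \<in> M" using M(2) by (rule subsetD[rotated])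
  moreover have "S \<subseteq> E" using S(2) unfolding E_def by blast
  then have "S \<subseteq> M" using M(2) by (rule subset_trans)
  ultimately show thesis by (rule that)
qed

section \<open>Sets closed under multiples and the class MAX*\<close>

lemma mem_multiples_iff: "0 < n \<Longrightarrow> k \<in> multiples n \<longleftrightarrow> 0 < k \<and> n dvd k"
  by (auto simp: multiples_def dvd_def)

lemma multiples_subset_Npos: "0 < n \<Longrightarrow> multiples n \<subseteq> Npos"
  by (auto simp: mem_multiples_iff)

lemma mem_up_closure_iff: "n \<in> up_closure A \<longleftrightarrow> 0 < n \<and> (\<exists>a\<in>A. a dvd n)"
  by (simp add: up_closure_def)

lemma subset_up_closure:
  assumes "A \<subseteq> Npos"
  shows "A \<subseteq> up_closure A"
proof
  fix a assume a: "a \<in> A"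
  then have "0 < a" using assms by auto
  then show "a \<in> up_closure A" using a unfolding mem_up_closure_iff by (metis dvd_refl)
qed

definition up_closed :: "nat set \<Rightarrow> bool" where
  "up_closed D \<longleftrightarrow> (\<forall>a\<in>D. 0 < a \<and> (\<forall>n>0. a dvd n \<longrightarrow> n \<in> D))"

lemma up_closed_pos: "up_closed D \<Longrightarrow> a \<in> D \<Longrightarrow> 0 < a"
  and up_closed_dvd: "up_closed D \<Longrightarrow> a \<in> D \<Longrightarrow> 0 < n \<Longrightarrow> a dvd n \<Longrightarrow> n \<in> D"
  unfolding up_closed_def by metis+

lemma up_closed_subset_Npos: "up_closed D \<Longrightarrow> D \<subseteq> Npos"
  using up_closed_pos by (metis greaterThan_iff subsetI)

lemma up_closed_up_closure: "up_closed (up_closure A)"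
  unfolding up_closed_def
proof (intro ballI conjI allI impI)
  fix a assume "a \<in> up_closure A"
  then obtain c where a: "0 < a" and c: "c \<in> A" "c dvd a"
    unfolding mem_up_closure_iff by auto
  show "0 < a" by (rule a)
  fix n assume "0 < n" "a dvd n"
  then show "n \<in> up_closure A"
    unfolding mem_up_closure_iff using c(1) dvd_trans[OF c(2)] by auto
qed

lemma up_closed_Npos: "up_closed Npos"
  by (simp add: up_closed_def)

lemma up_closed_Int: "up_closed D \<Longrightarrow> up_closed E \<Longrightarrow> up_closed (D \<inter> E)"
  unfolding up_closed_def by (metis IntD1 IntD2 IntI)

lemma up_closed_mult:
  assumes "up_closed D" "up_closed E" "a \<in> D" "b \<in> E"
  shows "a * b \<in> D \<inter> E"
proof -
  have "0 < a * b"
    using up_closed_pos[OF assms(1,3)] up_closed_pos[OF assms(2,4)] by simp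
  then show ?thesis using assms up_closed_dvd[of D a "a * b"] up_closed_dvd[of E b "a * b"] by simp
qed

lemma star_not_compl:
  assumes "star P A"
  shows "\<not> P (Npos - A)"
proof
  assume "P (Npos - A)"
  then have "A \<inter> (Npos - A) \<noteq> {}"
    using assms[unfolded star_def, rule_format, of "Npos - A"] by simp
  then show False by simp
qed

lemma multiples_in_MAX_ultrafilter:
  assumes "G \<in> MAX_ultrafilters" "0 < n"
  shows "multiples n \<in> G"
proof -
  have "up_closure {n} \<in> G"
    using assms principal_in_betaN[of n]
    unfolding MAX_ultrafilters_def uf_dvd_def by auto
  moreover have "up_closure {n} = multiples n"
    using assms(2) by (auto simp: up_closure_def mem_multiples_iff)
  ultimately show ?thesis by simp
qed

text \<open>
  If \<open>A\<close> includes no \<open>n\<nat>\<close>, its complement meets every nonempty set closed under multiples.  These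
  sets form a filter base, as \<open>a * b\<close> lies in the intersection whenever \<open>a\<close> and \<open>b\<close> lie in the two
  sets, and any ultrafilter extending that base is in \<open>MAX\<close>.
\<close>

lemma star_MAX_set_iff:
  assumes A: "A \<subseteq> Npos"
  shows "star MAX_set A \<longleftrightarrow> (\<exists>n>0. multiples n \<subseteq> A)"
proof
  assume "\<exists>n>0. multiples n \<subseteq> A"
  then obtain n where n: "0 < n" "multiples n \<subseteq> A" by blast
  show "star MAX_set A"
    unfolding star_def
  proof (intro allI impI)
    fix B assume "B \<subseteq> Npos \<and> MAX_set B"
    then obtain G where G: "G \<in> MAX_ultrafilters" "B \<in> G" by (auto simp: MAX_set_def)
    then have "multiples n \<inter> B \<noteq> {}"
      using multiples_in_MAX_ultrafilter[OF G(1) n(1)]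
      by (intro betaN_disjoint[of G]) (auto simp: MAX_ultrafilters_def)
    then show "A \<inter> B \<noteq> {}" using n(2) by blast
  qed
next
  assume star: "star MAX_set A"
  show "\<exists>n>0. multiples n \<subseteq> A"
  proof (rule ccontr)
    assume none: "\<not> (\<exists>n>0. multiples n \<subseteq> A)"
    define S where "S = {D. D \<noteq> {} \<and> up_closed D}"
    have base: "D \<inter> E \<in> S" if "D \<in> S" "E \<in> S" for D E
    proof -
      have DE: "up_closed D" "D \<noteq> {}" "up_closed E" "E \<noteq> {}" using that by (simp_all add: S_def)
      obtain a b where "a \<in> D" "b \<in> E" using DE(2,4) by auto
      then have "a * b \<in> D \<inter> E" by (rule up_closed_mult[OF DE(1,3)])
      then show ?thesis using up_closed_Int[OF DE(1,3)] unfolding S_def by auto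
    qed
    have meets: "D \<inter> (Npos - A) \<noteq> {}" if "D \<in> S" for D
    proof -
      have D: "up_closed D" "D \<noteq> {}" using that by (simp_all add: S_def)
      obtain n where n: "n \<in> D" using D(2) by auto
      then have pos: "0 < n" by (rule up_closed_pos[OF D(1)])
      then obtain k where k: "k \<in> multiples n" "k \<notin> A" using none by (metis subsetI)
      then have "0 < k" "n dvd k" using pos by (simp_all add: mem_multiples_iff)
      then have "k \<in> D" using up_closed_dvd[OF D(1) n] by simp
      then show ?thesis using k(2) \<open>0 < k\<close> by auto
    qed
    have "Npos \<in> S" using up_closed_Npos unfolding S_def by auto
    then have "S \<noteq> {}" by auto
    moreover have "S \<subseteq> Pow Npos"
      using up_closed_subset_Npos unfolding S_def
      by (metis (no_types, lifting) PowI mem_Collect_eq subsetI)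
    ultimately obtain G where G: "G \<in> betaN" "Npos - A \<in> G" "S \<subseteq> G"
      using ultrafilter_extension[of S "Npos - A", OF _ _ base meets] by auto
    have "uf_dvd F G" if F: "F \<in> betaN" for F
      unfolding uf_dvd_def
    proof
      fix X assume X: "X \<in> F"
      then have "up_closure X \<noteq> {}"
        using subset_up_closure[OF betaN_subset[OF F X]] betaN_empty[OF F] by auto
      then show "up_closure X \<in> G" using G(3) up_closed_up_closure by (auto simp: S_def)
    qed
    then have "MAX_set (Npos - A)" using G by (auto simp: MAX_set_def MAX_ultrafilters_def)
    then show False using star_not_compl[OF star] by simp
  qed
qed

section \<open>The smallest multiplicative ideal\<close>

text \<open>
  The smallest ideal lies inside every ideal, so its elements share whatever property defines one.
  For \<open>m\<close> divisible by \<open>n\<close> the quotient \<open>n\<nat> / m\<close> is all of \<open>\<nat>\<close>, and for every \<open>m\<close> it includes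
  \<open>n\<nat>\<close>; these observations settle the two sides of the product.
\<close>

lemma multiples_ideal:
  assumes n: "0 < n"
  shows "two_sided_ideal betaN uf_mult {F \<in> betaN. multiples n \<in> F}" (is "two_sided_ideal _ _ ?I")
  unfolding two_sided_ideal_def
proof (intro conjI ballI)
  have "multiples n \<in> {A. A \<subseteq> Npos \<and> n \<in> A}"
    using n by (auto simp: mem_multiples_iff)
  then have "{A. A \<subseteq> Npos \<and> n \<in> A} \<in> ?I"
    using principal_in_betaN[of n] n by simp
  then show "?I \<noteq> {}" by blast
  show "?I \<subseteq> betaN" by blast
  fix F G assume F: "F \<in> betaN" and "G \<in> ?I"
  then have G: "G \<in> betaN" "multiples n \<in> G" by auto
  have sub: "set_quot (multiples n) m \<subseteq> Npos" if "m \<in> Npos" for m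
    using that n by (auto simp: set_quot_eq mem_multiples_iff)
  have "set_quot (multiples n) m \<in> G" if m: "m \<in> Npos" for m
    using m n by (intro betaN_mono[OF G _ sub[OF m]]) (auto simp: set_quot_eq mem_multiples_iff)
  then have "{m \<in> Npos. set_quot (multiples n) m \<in> G} = Npos" by blast
  then show "uf_mult F G \<in> ?I"
    using uf_mult_in_betaN[OF F G(1)] betaN_Npos[OF F] multiples_subset_Npos[OF n]
    by (auto simp: uf_mult_def)
  have "set_quot (multiples n) m = Npos" if m: "m \<in> multiples n" for m
    using m n by (auto simp: set_quot_eq mem_multiples_iff)
  then have "multiples n \<subseteq> {m \<in> Npos. set_quot (multiples n) m \<in> F}"
    using betaN_Npos[OF F] multiples_subset_Npos[OF n] by auto
  then have "{m \<in> Npos. set_quot (multiples n) m \<in> F} \<in> G"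
    using betaN_mono[OF G] by blast
  then show "uf_mult G F \<in> ?I"
    using uf_mult_in_betaN[OF G(1) F] multiples_subset_Npos[OF n] by (auto simp: uf_mult_def)
qed

lemma smallest_ideal_D:
  assumes "F \<in> smallest_ideal betaN uf_mult"
  shows "F \<in> betaN" and "0 < n \<Longrightarrow> multiples n \<in> F"
proof -
  have F: "F \<in> {F \<in> betaN. multiples n \<in> F}" if "0 < n" for n
    using assms multiples_ideal[OF that] unfolding smallest_ideal_def by blast
  show "F \<in> betaN" using F[of 1] by simp
  show "0 < n \<Longrightarrow> multiples n \<in> F" using F by simp
qed

lemma M_central_meets_multiples:
  assumes "M_central B" "0 < n"
  shows "multiples n \<inter> B \<noteq> {}"
proof -
  obtain F where "F \<in> smallest_ideal betaN uf_mult" "B \<in> F"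
    using assms(1) by (auto simp: M_central_def)
  then show ?thesis
    using betaN_disjoint smallest_ideal_D assms(2) by metis
qed

section \<open>Additive IP sets\<close>

text \<open>
  Two of the partial sums \<open>x\<^sub>1 + \<dots> + x\<^sub>i\<close> agree modulo \<open>n\<close>; the block of terms between them
  is the required finite sum.
\<close>

lemma A_IP_meets_multiples:
  assumes "A_IP B" and n: "0 < n"
  shows "multiples n \<inter> B \<noteq> {}"
proof -
  obtain x where pos: "\<And>i. 0 < i \<Longrightarrow> 0 < x i"
    and sums: "\<And>F. F \<subseteq> Npos \<Longrightarrow> finite F \<Longrightarrow> F \<noteq> {} \<Longrightarrow> (\<Sum>i\<in>F. x i) \<in> B"
    using assms(1) unfolding A_IP_def by auto
  define s where "s i = (\<Sum>k\<in>{0<..i}. x k)" for i :: nat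
  have "\<not> inj_on (\<lambda>i. s i mod n) {0..n}"
  proof (rule pigeonhole)
    have "card ((\<lambda>i. s i mod n) ` {0..n}) \<le> card {0..<n}"
      using n by (intro card_mono) auto
    then show "card ((\<lambda>i. s i mod n) ` {0..n}) < card {0..n}" by simp
  qed
  then obtain i j where ij: "i < j" "s i mod n = s j mod n"
    unfolding inj_on_def using linorder_neqE_nat by metis
  define F where "F = {i<..j}"
  have "{0<..j} = {0<..i} \<union> F" using ij by (auto simp: F_def)
  then have "s j = s i + (\<Sum>k\<in>F. x k)"
    unfolding s_def by (simp add: sum.union_disjoint F_def)
  then have "n dvd (\<Sum>k\<in>F. x k)"
    using ij(2) by (metis add_diff_cancel_left' mod_eq_dvd_iff_nat le_add1)
  moreover have F: "F \<subseteq> Npos" "finite F" "F \<noteq> {}" using ij by (auto simp: F_def)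
  then have "0 < (\<Sum>k\<in>F. x k)" using pos by (intro sum_pos) (auto simp: subset_iff)
  ultimately show ?thesis
    using sums[OF F] n by (auto simp: mem_multiples_iff)
qed

section \<open>Sparsity of the factorials\<close>

text \<open>Without the bound on \<open>k\<close>, \<open>1! + 1! = 2!\<close> would be a relation between factorials.\<close>

definition factorials :: "nat set" where
  "factorials = {fact k | k. 2 \<le> k}"

lemma factorials_subset_Npos: "factorials \<subseteq> Npos"
  by (auto simp: factorials_def)

lemma fact_Suc_mult_le:
  assumes "a < b"
  shows "Suc a * fact a \<le> (fact b :: nat)"
  using fact_mono_nat[of "Suc a" b] assms by (simp del: mult_Suc)

lemma nonfactorials_not_star_MAX: "\<not> star MAX_set (Npos - factorials)"
proof
  assume "star MAX_set (Npos - factorials)"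
  then obtain n where n: "0 < n" "multiples n \<subseteq> Npos - factorials"
    using star_MAX_set_iff[OF Diff_subset] by metis
  have "n dvd fact (n + 2)" using n(1) by (intro dvd_fact) simp_all
  then have "fact (n + 2) \<in> multiples n" using n(1) by (simp add: mem_multiples_iff del: fact_Suc)
  then have "fact (n + 2) \<notin> factorials" using n(2) by (metis DiffD2 subsetD)
  moreover have "fact (n + 2) \<in> factorials"
    unfolding factorials_def by (intro CollectI exI[of _ "n + 2"]) simp
  ultimately show False by simp
qed

lemma factorials_sum_free:
  assumes "u \<in> factorials" "v \<in> factorials"
  shows "u + v \<notin> factorials"
  using assms
proof (induction u v rule: linorder_wlog)
  case (le u v)
  then obtain b where b: "v = fact b" "2 \<le> b" "0 < u" by (auto simp: factorials_def)
  show ?case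
  proof
    assume "u + v \<in> factorials"
    then obtain c where c: "u + v = fact c" by (auto simp: factorials_def)
    then have "\<not> c \<le> b" using b fact_mono_nat[of c b] by auto
    then have "Suc b * v \<le> u + v" using c b fact_Suc_mult_le[of b c] by simp
    moreover have "3 * v \<le> Suc b * v" using b by (intro mult_le_mono1) simp
    ultimately have "3 * v \<le> u + v" by (rule le_trans[rotated])
    moreover have "0 < v" using b(1) by simp
    ultimately show False using le(1) by linarith
  qed
next
  case (sym u v)
  then show ?case by (simp add: add.commute)
qed

lemma nonfactorials_star_A_IP: "star A_IP (Npos - factorials)"
  unfolding star_def
proof (intro allI impI notI)
  fix B assume B: "B \<subseteq> Npos \<and> A_IP B" and "(Npos - factorials) \<inter> B = {}"
  then have sub: "B \<subseteq> factorials" by blast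
  obtain x where sums: "\<And>F. F \<subseteq> Npos \<Longrightarrow> finite F \<Longrightarrow> F \<noteq> {} \<Longrightarrow> (\<Sum>i\<in>F. x i) \<in> B"
    using B unfolding A_IP_def by metis
  have "x 1 \<in> B" "x 2 \<in> B" "x 1 + x 2 \<in> B"
    using sums[of "{1}"] sums[of "{2}"] sums[of "{1,2}"] by auto
  then show False using sub factorials_sum_free by blast
qed

text \<open>
  If \<open>m * k = a!\<close> and \<open>m' * k = b!\<close> with \<open>m < m'\<close>, then \<open>m'\<close> exceeds \<open>m\<close> by a factor of at least
  \<open>a + 1\<close>, which bounds \<open>a\<close> and thereby \<open>k\<close>.
\<close>

lemma common_cofactor_bounded:
  assumes "0 < m" "m < m'" "m * k \<in> factorials" "m' * k \<in> factorials"
  shows "k \<le> fact m'"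
proof -
  obtain a b where ab: "m * k = fact a" "m' * k = fact b"
    using assms by (auto simp: factorials_def)
  have k: "0 < k" using ab(1) by (cases k) auto
  have "(fact a :: nat) < fact b" using ab k assms by (simp flip: ab)
  then have "a < b" using fact_mono_nat[of b a] by (meson not_less)
  then have "Suc a * m * k \<le> m' * k"
    using fact_Suc_mult_le[of a b] ab by (simp add: mult.assoc del: mult_Suc)
  then have "Suc a * m \<le> m'" using k by (meson mult_le_cancel2)
  moreover have "Suc a * 1 \<le> Suc a * m" using assms(1) by (intro mult_le_mono2) simp
  ultimately have "Suc a * 1 \<le> m'" by (rule le_trans[rotated])
  then have "a \<le> m'" by simp
  then have "fact a \<le> (fact m' :: nat)" by (rule fact_mono_nat)
  moreover have "k \<le> m * k" using assms by simp
  ultimately show ?thesis using ab by linarith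
qed

text \<open>
  If an idempotent contained the factorials, it would contain their quotients by many
  different numbers; but two of these quotients have a finite intersection.  Membership of all
  \<open>n\<nat>\<close> stands in for nonprincipality: it supplies arbitrarily large elements in every member.
\<close>

lemma factorials_notin_idempotent:
  assumes F: "F \<in> betaN" and mult: "\<And>n. 0 < n \<Longrightarrow> multiples n \<in> F"
    and idem: "uf_mult F F = F"
  shows "factorials \<notin> F"
proof
  assume "factorials \<in> F"
  then have "factorials \<in> uf_mult F F" using idem by simp
  then have Q: "{m \<in> Npos. set_quot factorials m \<in> F} \<in> F" (is "?Q \<in> F")
    by (simp add: uf_mult_def)
  have large: "\<exists>k\<in>A. n < k" if A: "A \<in> F" for A n
  proof -
    obtain k where k: "k \<in> multiples (Suc n)" "k \<in> A"
      using betaN_disjoint[OF F mult A] by blast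
    then have "0 < k" "Suc n dvd k" by (auto simp: mem_multiples_iff)
    then have "n < k" by (meson dvd_imp_le less_eq_Suc_le)
    then show ?thesis using k(2) by blast
  qed
  obtain m where m: "m \<in> ?Q" using large[OF Q] by blast
  obtain m' where m': "m' \<in> ?Q" "m < m'" using large[OF Q] by blast
  have "set_quot factorials m \<inter> set_quot factorials m' \<in> F"
    using m m' betaN_Int[OF F] by blast
  then obtain k where "k \<in> set_quot factorials m" "k \<in> set_quot factorials m'" "fact m' < k"
    using large by blast
  then show False
    using m m' common_cofactor_bounded[of m m' k] by (auto simp: set_quot_eq)
qed

lemma nonfactorials_star_M_central: "star M_central (Npos - factorials)"
  unfolding star_def
proof (intro allI impI)
  fix B assume "B \<subseteq> Npos \<and> M_central B"
  then obtain F where F: "F \<in> smallest_ideal betaN uf_mult" "uf_mult F F = F" "B \<in> F"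
    by (auto simp: M_central_def)
  have "factorials \<notin> F"
    using factorials_notin_idempotent[OF smallest_ideal_D[OF F(1)] F(2)] .
  then have "Npos - factorials \<in> F"
    using betaN_compl[OF smallest_ideal_D(1)[OF F(1)] factorials_subset_Npos] by simp
  then show "(Npos - factorials) \<inter> B \<noteq> {}"
    using betaN_disjoint[OF smallest_ideal_D(1)[OF F(1)]] F(3) by simp
qed

lemma nonfactorials_A_thick: "A_thick (Npos - factorials)"
  unfolding A_thick_def
proof
  fix n :: nat
  have sparse: "fact (Suc n) + i \<notin> factorials" if i: "i \<in> {1..n}" for i
  proof
    assume "fact (Suc n) + i \<in> factorials"
    then obtain c where c: "fact (Suc n) + i = fact c" by (auto simp: factorials_def)
    then have "\<not> c \<le> Suc n" using i fact_mono_nat[of c "Suc n"] by auto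
    then have "Suc (Suc n) * fact (Suc n) \<le> fact (Suc n) + i"
      using c fact_Suc_mult_le[of "Suc n" c] by (simp del: fact_Suc)
    then have "Suc n * fact (Suc n) \<le> i" by (simp del: fact_Suc)
    moreover have "Suc n * 1 \<le> Suc n * fact (Suc n)"
      by (intro mult_le_mono2) (rule fact_ge_1)
    ultimately show False using i by simp
  qed
  have "{fact (Suc n) + 1..fact (Suc n) + n} \<subseteq> Npos - factorials"
  proof
    fix k assume "k \<in> {fact (Suc n) + 1..fact (Suc n) + n}"
    then have k: "fact (Suc n) + 1 \<le> k" "k \<le> fact (Suc n) + n" by (simp_all del: fact_Suc)
    then have "k - fact (Suc n) \<in> {1..n}" unfolding atLeastAtMost_iff by linarith
    then have "fact (Suc n) + (k - fact (Suc n)) \<notin> factorials" by (rule sparse)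
    moreover have "fact (Suc n) + (k - fact (Suc n)) = k" using k(1) by linarith
    moreover have "k \<in> Npos" using k(1) by (simp del: fact_Suc)
    ultimately show "k \<in> Npos - factorials" by (simp del: fact_Suc)
  qed
  then show "\<exists>m\<in>Npos. {m + 1..m + n} \<subseteq> Npos - factorials"
    by (rule bexI) (simp del: fact_Suc)
qed

section \<open>Members of \<open>\<nat>\<close>-free ultrafilters\<close>

definition coprime_rich :: "nat set \<Rightarrow> bool" where
  "coprime_rich D \<longleftrightarrow> (\<forall>N>0. \<exists>a\<in>D. coprime a N)"

text \<open>
  An element is coprime to \<open>N\<close> as soon as it avoids \<open>d\<nat>\<close> for the finitely many divisors \<open>d > 1\<close>
  of \<open>N\<close>, and the complements of these sets all belong to the ultrafilter.
\<close>

lemma N_free_coprime_rich: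
  assumes F: "F \<in> betaN" and free: "N_free F" and A: "A \<in> F"
  shows "coprime_rich A"
  unfolding coprime_rich_def
proof (intro allI impI)
  fix N :: nat assume N: "0 < N"
  define P where "P = {d. d dvd N \<and> 1 < d}"
  have "finite P" unfolding P_def using N by simp
  moreover have "d \<in> P \<Longrightarrow> Npos - multiples d \<in> F" for d
    using free betaN_compl[OF F] multiples_subset_Npos[of d] by (auto simp: P_def N_free_def)
  ultimately have "A \<inter> (\<Inter>d\<in>P. Npos - multiples d) \<in> F"
  proof (induction P)
    case (insert d P)
    then have "(Npos - multiples d) \<inter> (A \<inter> (\<Inter>d\<in>P. Npos - multiples d)) \<in> F"
      using betaN_Int[OF F] by simp
    then show ?case by (simp add: Int_left_commute)
  qed (simp add: A)
  then have "A \<inter> (\<Inter>d\<in>P. Npos - multiples d) \<noteq> {}"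
    using betaN_empty[OF F] by metis
  then obtain a where "a \<in> A \<inter> (\<Inter>d\<in>P. Npos - multiples d)"
    unfolding ex_in_conv[symmetric] ..
  then have a: "a \<in> A" "\<And>d. d \<in> P \<Longrightarrow> a \<notin> multiples d"
    unfolding Int_iff INT_iff Diff_iff by simp_all
  have "0 < a" using betaN_subset[OF F A] a(1) by auto
  then have "gcd a N \<notin> P" using a(2)[of "gcd a N"] N by (auto simp: mem_multiples_iff)
  then have "gcd a N = 1" using N by (auto simp: P_def not_less_iff_gr_or_eq)
  then show "\<exists>a\<in>A. coprime a N" using a(1) by (auto simp: coprime_iff_gcd_eq_1)
qed

lemma coprime_rich_Int:
  assumes D: "up_closed D" "coprime_rich D" and E: "up_closed E" "coprime_rich E"
  shows "coprime_rich (D \<inter> E)"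
  unfolding coprime_rich_def
proof (intro allI impI)
  fix N :: nat assume "0 < N"
  then obtain a b where ab: "a \<in> D" "coprime a N" "b \<in> E" "coprime b N"
    using D(2) E(2) unfolding coprime_rich_def by metis
  then have "a * b \<in> D \<inter> E" by (intro up_closed_mult[OF D(1) E(1)])
  moreover have "coprime (a * b) N" using ab by simp
  ultimately show "\<exists>c\<in>D \<inter> E. coprime c N" by (rule bexI[rotated])
qed

lemma coprime_rich_pairwise:
  assumes D: "D \<subseteq> Npos" "coprime_rich D"
  shows "\<exists>b::nat \<Rightarrow> nat. (\<forall>j<n. b j \<in> D) \<and> (\<forall>i<n. \<forall>j<n. i \<noteq> j \<longrightarrow> coprime (b i) (b j))"
proof (induction n)
  case (Suc n)
  then obtain b where b: "\<And>j. j < n \<Longrightarrow> b j \<in> D"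
    "\<And>i j. i < n \<Longrightarrow> j < n \<Longrightarrow> i \<noteq> j \<Longrightarrow> coprime (b i) (b j)" by metis
  have "0 < b j" if "j < n" for j using subsetD[OF D(1) b(1)[OF that]] by simp
  then have "0 < (\<Prod>j<n. b j)" by (intro prod_pos) simp
  then obtain a where a: "a \<in> D" "coprime a (\<Prod>j<n. b j)"
    using D(2) unfolding coprime_rich_def by metis
  have a': "coprime a (b j)" if "j < n" for j
  proof -
    have "b j dvd (\<Prod>j<n. b j)" using that by (intro dvd_prodI) simp_all
    then show ?thesis using a(2) by (rule coprime_divisors[OF dvd_refl])
  qed
  define c where "c = b(n := a)"
  have "c j \<in> D" if "j < Suc n" for j
    using that a(1) b(1)[of j] by (cases "j = n") (simp_all add: c_def)
  moreover have "coprime (c i) (c j)" if "i < Suc n" "j < Suc n" "i \<noteq> j" for i j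
    using that b(2)[of i j] a'[of i] a'[of j] coprime_commute[of "b i" a]
    by (cases "i = n"; cases "j = n") (simp_all add: c_def)
  ultimately show ?case by metis
qed simp

text \<open>
  With pairwise coprime \<open>b\<^sub>1, \<dots>, b\<^sub>n\<close> in the set, the Chinese remainder theorem gives
  \<open>m\<close> such that each \<open>b\<^sub>j\<close> divides \<open>m + j\<close>.
\<close>

lemma coprime_rich_A_thick:
  assumes D: "up_closed D" "coprime_rich D"
  shows "A_thick D"
  unfolding A_thick_def
proof
  fix n :: nat
  have sub: "D \<subseteq> Npos" using D(1) by (rule up_closed_subset_Npos)
  obtain b where b: "\<And>j. j < n \<Longrightarrow> b j \<in> D"
    "\<And>i j. i < n \<Longrightarrow> j < n \<Longrightarrow> i \<noteq> j \<Longrightarrow> coprime (b i) (b j)"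
    using coprime_rich_pairwise[OF sub D(2), of n] by metis
  \<comment> \<open>The \<open>j\<close>-th residue is \<open>-(j + 2)\<close>: the index starts at \<open>0\<close>, and \<open>m\<close> is taken to be
    the solution plus one, since it has to be positive.\<close>
  obtain x where x: "\<And>j. j < n \<Longrightarrow> [x = b j * (j + 2) - (j + 2)] (mod b j)"
    using chinese_remainder_nat[of "{..<n}" b "\<lambda>j. b j * (j + 2) - (j + 2)"] b(2) by auto
  have shifted: "x + 2 + j \<in> D" if j: "j < n" for j
  proof -
    have "1 \<le> b j" using subsetD[OF sub b(1)[OF j]] by simp
    then have "1 * (j + 2) \<le> b j * (j + 2)" by (rule mult_le_mono1)
    then have "b j * (j + 2) - (j + 2) + (j + 2) = b j * (j + 2)"
      unfolding mult_1 by (rule le_add_diff_inverse2)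
    moreover have "[x + (j + 2) = b j * (j + 2) - (j + 2) + (j + 2)] (mod b j)"
      using x[OF j] by (rule cong_add) simp
    ultimately have "[x + (j + 2) = b j * (j + 2)] (mod b j)" by metis
    then have "b j dvd x + (j + 2)" by (simp add: cong_dvd_iff)
    then have "b j dvd x + 2 + j" by (simp add: ac_simps)
    then show ?thesis using up_closed_dvd[OF D(1) b(1)[OF j]] by simp
  qed
  have "{Suc x + 1..Suc x + n} \<subseteq> D"
  proof
    fix k assume "k \<in> {Suc x + 1..Suc x + n}"
    then have "k - (x + 2) < n" "x + 2 + (k - (x + 2)) = k" by auto
    then show "k \<in> D" using shifted[of "k - (x + 2)"] by metis
  qed
  then show "\<exists>m\<in>Npos. {m + 1..m + n} \<subseteq> D" by (rule bexI) simp
qed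

lemma star_NMAX_set_A_thick:
  assumes A: "A \<subseteq> Npos" and star: "star NMAX_set A"
  shows "A_thick A"
proof (rule ccontr)
  assume not_thick: "\<not> A_thick A"
  define S where "S = {D. up_closed D \<and> coprime_rich D}"
  have meets: "D \<inter> (Npos - A) \<noteq> {}" if "D \<in> S" for D
  proof
    assume "D \<inter> (Npos - A) = {}"
    moreover have "D \<subseteq> Npos" using that up_closed_subset_Npos by (simp add: S_def)
    ultimately have "D \<subseteq> A" by auto
    moreover have "A_thick D" using that coprime_rich_A_thick by (simp add: S_def)
    ultimately have "A_thick A" unfolding A_thick_def by (meson subset_trans)
    then show False using not_thick by simp
  qed
  have "coprime_rich Npos"
    unfolding coprime_rich_def by (auto intro!: bexI[of _ 1])
  then have "Npos \<in> S" using up_closed_Npos by (simp add: S_def)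
  then have nonempty: "S \<noteq> {}" by auto
  have sub: "S \<subseteq> Pow Npos"
    using up_closed_subset_Npos unfolding S_def
    by (metis (no_types, lifting) PowI mem_Collect_eq subsetI)
  have Int: "D \<inter> E \<in> S" if "D \<in> S" "E \<in> S" for D E
    using that up_closed_Int coprime_rich_Int by (simp add: S_def)
  obtain G where G: "G \<in> betaN" "Npos - A \<in> G" "S \<subseteq> G"
    by (rule ultrafilter_extension[OF nonempty sub Int meets Diff_subset])
  have "uf_dvd F G" if F: "F \<in> betaN" "N_free F" for F
    unfolding uf_dvd_def
  proof
    fix X assume X: "X \<in> F"
    then have "coprime_rich (up_closure X)"
      using N_free_coprime_rich[OF F X] subset_up_closure[OF betaN_subset[OF F(1) X]]
      unfolding coprime_rich_def by (meson subsetD)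
    then show "up_closure X \<in> G" using G(3) up_closed_up_closure by (auto simp: S_def)
  qed
  then have "NMAX_set (Npos - A)" using G by (auto simp: NMAX_set_def NMAX_ultrafilters_def)
  then show False using star_not_compl[OF star] by simp
qed

section \<open>The implications and their failures\<close>

lemma multiples_2_not_A_thick: "\<not> A_thick (multiples 2)"
proof
  assume "A_thick (multiples 2)"
  then have "\<exists>m\<in>Npos. {m + 1..m + 2} \<subseteq> multiples 2"
    unfolding A_thick_def by (rule bspec) simp
  then obtain m where "{m + 1..m + 2} \<subseteq> multiples 2" by blast
  then have "m + 1 \<in> multiples 2" "m + 2 \<in> multiples 2" by auto
  then show False by (simp add: mem_multiples_iff)
qed

theorem theorem5p2:
  shows "(prop_implies (star MAX_set) (star M_central) \<and>
          \<not> prop_implies (star M_central) (star MAX_set)) \<and>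
         (prop_implies (star MAX_set) (star A_IP) \<and>
          \<not> prop_implies (star A_IP) (star MAX_set)) \<and>
         (\<not> prop_implies A_thick (star MAX_set) \<and>
          \<not> prop_implies (star MAX_set) A_thick) \<and>
         prop_implies (star NMAX_set) A_thick"
proof (intro conjI)
  have not_implies: "\<not> prop_implies P Q" if "A \<subseteq> Npos" "P A" "\<not> Q A" for P Q A
    using that unfolding prop_implies_def by metis
  have nonfactorials_counterexample: "\<not> prop_implies P (star MAX_set)" if "P (Npos - factorials)" for P
    by (rule not_implies[where A = "Npos - factorials"])
      (rule Diff_subset, rule that, rule nonfactorials_not_star_MAX)
  show "\<not> prop_implies (star M_central) (star MAX_set)"
    by (rule nonfactorials_counterexample) (rule nonfactorials_star_M_central)
  show "\<not> prop_implies (star A_IP) (star MAX_set)"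
    by (rule nonfactorials_counterexample) (rule nonfactorials_star_A_IP)
  show "\<not> prop_implies A_thick (star MAX_set)"
    by (rule nonfactorials_counterexample) (rule nonfactorials_A_thick)
  have transfer: "prop_implies (star MAX_set) (star P)"
    if meets: "\<And>B n. P B \<Longrightarrow> 0 < n \<Longrightarrow> multiples n \<inter> B \<noteq> {}" for P
    unfolding prop_implies_def
  proof (intro allI impI)
    fix A assume A: "A \<subseteq> Npos \<and> star MAX_set A"
    then obtain n where n: "0 < n" "multiples n \<subseteq> A"
      using star_MAX_set_iff[of A] by metis
    have "A \<inter> B \<noteq> {}" if "P B" for B
      using meets[OF that n(1)] n(2) by auto
    then show "star P A" by (simp add: star_def)
  qed
  show "prop_implies (star MAX_set) (star M_central)"
    by (rule transfer) (rule M_central_meets_multiples)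
  show "prop_implies (star MAX_set) (star A_IP)"
    by (rule transfer) (rule A_IP_meets_multiples)
  have even: "multiples 2 \<subseteq> Npos" by (simp add: multiples_subset_Npos)
  have "star MAX_set (multiples 2)"
    unfolding star_MAX_set_iff[OF even] by (rule exI[of _ 2]) simp
  then show "\<not> prop_implies (star MAX_set) A_thick"
    using even multiples_2_not_A_thick by (intro not_implies[where A = "multiples 2"])
  show "prop_implies (star NMAX_set) A_thick"
    using star_NMAX_set_A_thick unfolding prop_implies_def by metis
qed

end
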